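(* Let $n\ge 2$, let $U\subset\mathbb{R}^n$ be open, let $X\in C^2(U,\mathbb{R}^n)$, $p\in U$ with $X(p)=0$, put $J:=DX(p)$, and assume that $\operatorname{rank}J=n-1$, $e_{n-1}(J)=0$ and $e_{n-2}(J)\neq 0$. Let $q_0$ span $\ker J$ and let $(a,b)$ be the Bogdanov--Takens coefficients associated with $(X,p,q_0)$. Then for every $\lambda$, $$\sum_{k=0}^{n}(-1)^k\bigl(D_{q_0}e_k\bigr)\lambda^{n-k}=-\chi_{\mathrm{tr}}(\lambda)\,(b\lambda+2a)-\lambda^2\,\operatorname{tr}\bigl(\operatorname{adj}(\lambda I-J_{\mathrm{tr}})\,L_{\mathrm{tr}}\bigr),$$ where $D_{q_0}e_k:=\frac{d}{ds}\big|_{s=0}e_k\bigl(DX(p+sq_0)\bigr)$. For $n=2$ the last term is $0$.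
   Context: For a real $m\times m$ matrix $A$, $e_k(A)$ is the sum of the principal $k\times k$ minors of $A$, so that $\chi_A(\lambda):=\det(\lambda I-A)=\sum_{k=0}^m(-1)^k e_k(A)\lambda^{m-k}$; $e_0(A)=1$ and $e_k(A):=0$ for $k<0$. For the empty ($0\times0$) matrix: $\chi_A=1$, $\det A=1$, $\operatorname{adj}A=1$, $\operatorname{tr}A=0$ (used only when $n=2$). $\operatorname{adj}$ is the adjugate. Under the stated conditions, $\mathbb{R}^n=E^c\oplus E^{\mathrm{tr}}$ with $E^c:=\ker J^2$, $E^{\mathrm{tr}}:=\operatorname{im}J^2$, both $J$-invariant, $\dim E^c=2$, $J|_{E^c}$ nilpotent of rank one, and $J_{\mathrm{tr}}:=J|_{E^{\mathrm{tr}}}$ invertible; $\chi_{\mathrm{tr}}:=\chi_{J_{\mathrm{tr}}}$. Let $B(u,v):=D^2X(p)[u,v]$ and $L:=\frac{d}{ds}\big|_{s=0}DX(p+sq_0)$, i.e. $Lw=B(q_0,w)$. $L_{\mathrm{tr}}:=\Pi_{\mathrm{tr}}L|_{E^{\mathrm{tr}}}$, where $\Pi_{\mathrm{tr}}$ is the projection onto $E^{\mathrm{tr}}$ along $E^c$. Definition of $(a,b)$: choose $q_1\in E^c$ with $Jq_1=q_0$; let $p_0,p_1$ be the covectors determined by $\langle p_0,q_0\rangle=\langle p_1,q_1\rangle=1$, $\langle p_0,q_1\rangle=\langle p_1,q_0\rangle=0$, $p_0|_{E^{\mathrm{tr}}}=p_1|_{E^{\mathrm{tr}}}=0$. Then $$a:=\tfrac12\langle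 p_1,B(q_0,q_0)\rangle,\qquad b:=\langle p_0,B(q_0,q_0)\rangle+\langle p_1,B(q_0,q_1)\rangle ,$$ and $(a,b)$ does not depend on the choice of $q_1$. *)

theory Defs
  imports
    "HOL-Analysis.Analysis"
    "Jordan_Normal_Form.Determinant"
    "Jordan_Normal_Form.Char_Poly"
begin

text \<open>The determinant of the submatrix of \<open>A\<close> with rows and columns in \<open>S\<close>, written as the
  Leibniz sum over the permutations of \<open>S\<close>; it is \<open>1\<close> for \<open>S = {}\<close>.\<close>

definition principal_minor :: "real^'n^'n \<Rightarrow> 'n set \<Rightarrow> real" where
  "principal_minor A S =
     (\<Sum>\<pi> | \<pi> permutes S. of_int (sign \<pi>) * (\<Prod>i\<in>S. vec_nth (vec_nth A i) (\<pi> i)))"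

definition sum_minors :: "nat \<Rightarrow> real^'n^'n \<Rightarrow> real" where
  "sum_minors k A = (\<Sum>S | S \<subseteq> UNIV \<and> card S = k. principal_minor A S)"

definition C2_on :: "('a::euclidean_space \<Rightarrow> 'b::euclidean_space) \<Rightarrow> 'a set \<Rightarrow> bool" where
  "C2_on f U \<longleftrightarrow>
     (\<exists>(f' :: 'a \<Rightarrow> 'a \<Rightarrow>\<^sub>L 'b) (f'' :: 'a \<Rightarrow> 'a \<Rightarrow>\<^sub>L 'a \<Rightarrow>\<^sub>L 'b).
        (\<forall>x\<in>U. (f has_derivative blinfun_apply (f' x)) (at x)) \<and>
        (\<forall>x\<in>U. (f' has_derivative blinfun_apply (f'' x)) (at x)) \<and>
        continuous_on U f'')"

definition second_derivative ::
    "('a::real_normed_vector \<Rightarrow> 'b::real_normed_vector) \<Rightarrow> 'a \<Rightarrow> 'a \<Rightarrow> 'a \<Rightarrow> 'b" where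
  "second_derivative f p u v =
     frechet_derivative (\<lambda>x. frechet_derivative f (at x) v) (at p) u"

definition center_space :: "real^'n^'n \<Rightarrow> (real^'n) set" where
  "center_space J = {x. (J ** J) *v x = 0}"

definition transverse_space :: "real^'n^'n \<Rightarrow> (real^'n) set" where
  "transverse_space J = range (\<lambda>x. (J ** J) *v x)"

text \<open>The projection onto the transverse space along the center space. It is meaningful only when
  these two subspaces are complementary.\<close>

definition transverse_proj :: "real^'n^'n \<Rightarrow> real^'n \<Rightarrow> real^'n" where
  "transverse_proj J x = (THE y. y \<in> transverse_space J \<and> x - y \<in> center_space J)"

text \<open>That \<open>a\<close>, \<open>b\<close> are the Bogdanov--Takens coefficients of \<open>(X, p, q0)\<close>, obtained from some
  choice of \<open>q1\<close>; the covectors \<open>p0\<close>, \<open>p1\<close> are then determined. As the coefficients do not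
  depend on \<open>q1\<close>, the relation is single-valued in \<open>(a, b)\<close>.\<close>

definition BT_coefficients ::
    "(real^'n \<Rightarrow> real^'n) \<Rightarrow> real^'n \<Rightarrow> real^'n \<Rightarrow> real \<Rightarrow> real \<Rightarrow> bool" where
  "BT_coefficients X p q0 a b \<longleftrightarrow>
     (let J = jacobian X (at p); B = second_derivative X p in
      \<exists>q1 (p0 :: real^'n \<Rightarrow> real) (p1 :: real^'n \<Rightarrow> real).
        q1 \<in> center_space J \<and> J *v q1 = q0 \<and>
        linear p0 \<and> linear p1 \<and>
        p0 q0 = 1 \<and> p1 q1 = 1 \<and> p0 q1 = 0 \<and> p1 q0 = 0 \<and>
        (\<forall>x\<in>transverse_space J. p0 x = 0 \<and> p1 x = 0) \<and>
        a = 1/2 * p1 (B q0 q0) \<and>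
        b = p0 (B q0 q0) + p1 (B q0 q1))"

definition ordered_basis :: "'a::real_vector set \<Rightarrow> 'a list \<Rightarrow> bool" where
  "ordered_basis V bs \<longleftrightarrow> distinct bs \<and> independent (set bs) \<and> span (set bs) = V"

lemma ordered_basis_exists:
  fixes V :: "'a::euclidean_space set"
  assumes "subspace V"
  shows "\<exists>bs. ordered_basis V bs"
proof -
  obtain C where C: "C \<subseteq> V" "independent C" "V \<subseteq> span C"
    by (rule basis_exists)
  have fin: "finite C" using C(2) by (rule independent_imp_finite)
  from finite_distinct_list[OF fin] obtain bs where bs: "set bs = C" "distinct bs" by (elim exE conjE)
  have sp: "span C = V"
    using span_minimal[OF C(1) assms] C(3) by (rule subset_antisym)
  have "ordered_basis V bs" unfolding ordered_basis_def bs(1) using bs(2) C(2) sp by (intro conjI)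
  then show ?thesis by (rule exI)
qed

text \<open>The matrix, in the ordered basis \<open>bs\<close>, of an endomorphism of the span of \<open>bs\<close>, given as a
  function \<open>T\<close> on the ambient space that maps this span into itself. Column \<open>j\<close> holds the
  coordinates of the image of the \<open>j\<close>-th basis vector. The matrix is \<open>0 \<times> 0\<close> if \<open>bs\<close> is empty.\<close>

definition coord_matrix :: "'a::real_vector list \<Rightarrow> ('a \<Rightarrow> 'a) \<Rightarrow> real mat" where
  "coord_matrix bs T =
     Matrix.mat (length bs) (length bs) (\<lambda>(i, j). representation (set bs) (T (bs ! j)) (bs ! i))"

definition mat_trace :: "real mat \<Rightarrow> real" where
  "mat_trace M = (\<Sum>i<dim_row M. M $$ (i, i))"

end

theory Submission
  imports Defs
begin

text \<open>The alternating sum is the derivative at \<open>s = 0\<close> of \<open>det (\<lambda> I - DX(p + s q\<^sub>0))\<close>, and the derivative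
  of a determinant is the trace of the adjugate times the derivative of the matrix. In a basis
  \<open>q\<^sub>0, q\<^sub>1, bs\<close> with \<open>bs\<close> spanning the image of \<open>J\<^sup>2\<close>, the matrix \<open>\<lambda> I - J\<close> is block diagonal, with blocks
  \<open>[[\<lambda>, -1], [0, \<lambda>]]\<close> and \<open>\<lambda> I - J\<^sub>t\<^sub>r\<close>. So the trace only sees the two diagonal blocks of the matrix of
  \<open>L\<close>: the first one gives \<open>b \<lambda> + 2 a\<close>, the second one is \<open>L\<^sub>t\<^sub>r\<close>.\<close>

no_notation vec_index (infixl "$" 100)
no_notation scalar_prod (infix "\<bullet>" 70)

section \<open>Principal minors as coefficients of the characteristic polynomial\<close>

lemma permutes_UNIV_fixing_iff:
  "\<pi> permutes UNIV \<and> (\<forall>i\<in>-S. \<pi> i = i) \<longleftrightarrow> \<pi> permutes S"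
  by (auto simp: permutes_def)

text \<open>Multiply out each Leibniz product, letting \<open>S\<close> be the set of rows from
  which the \<open>- A\<close> entry is taken. On the complement the remaining factors are entries
  of \<lambda> I, which vanish unless \<pi> fixes that complement pointwise. So only permutations of
  \<open>S\<close> survive; they form the minor of \<open>S\<close>, and grouping by
  \<open>card S\<close> gives the powers of \<lambda>.\<close>

lemma det_mat_minus_eq_sum_minors:
  fixes A :: "real^'n^'n"
  shows "Determinants.det (Finite_Cartesian_Product.mat lam - A)
       = (\<Sum>k=0..CARD('n). (-1) ^ k * sum_minors k A * lam ^ (CARD('n) - k))"
proof -
  let ?P = "{\<pi>. \<pi> permutes (UNIV :: 'n set)}"
  let ?d = "\<lambda>\<pi> i. if i = \<pi> i then lam else 0 :: real"
  have diag: "(\<Prod>i\<in>-S. ?d \<pi> i) = (if \<forall>i\<in>-S. \<pi> i = i then lam ^ card (-S) else 0)"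
    for \<pi> and S :: "'n set"
  proof (cases "\<forall>i\<in>-S. \<pi> i = i")
    case True
    then have "(\<Prod>i\<in>-S. ?d \<pi> i) = (\<Prod>i\<in>-S. lam)"
      by (intro prod.cong) auto
    then show ?thesis
      using True by simp
  next
    case False
    then obtain i where "i \<in> -S" "i \<noteq> \<pi> i"
      by fastforce
    then have "(\<Prod>i\<in>-S. ?d \<pi> i) = 0"
      by (intro prod_zero) auto
    then show ?thesis
      using False by (simp only: if_False)
  qed
  have expand: "(\<Prod>i\<in>UNIV. (Finite_Cartesian_Product.mat lam - A) $ i $ \<pi> i)
      = (\<Sum>S\<in>UNIV. (\<Prod>i\<in>S. - A $ i $ \<pi> i) * (\<Prod>i\<in>-S. ?d \<pi> i))" for \<pi>
    using prod_add[OF finite_class.finite_UNIV, of "\<lambda>i. - A $ i $ \<pi> i" "?d \<pi>"]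
    by (simp add: Finite_Cartesian_Product.mat_def Compl_eq_Diff_UNIV)
  have inner: "(\<Sum>\<pi>\<in>?P. of_int (sign \<pi>) * ((\<Prod>i\<in>S. - A $ i $ \<pi> i) * (\<Prod>i\<in>-S. ?d \<pi> i)))
      = (-1) ^ card S * principal_minor A S * lam ^ (CARD('n) - card S)" for S
  proof -
    have "(\<Sum>\<pi>\<in>?P. of_int (sign \<pi>) * ((\<Prod>i\<in>S. - A $ i $ \<pi> i) * (\<Prod>i\<in>-S. ?d \<pi> i)))
        = (\<Sum>\<pi> | \<pi> permutes S. of_int (sign \<pi>) * ((\<Prod>i\<in>S. - A $ i $ \<pi> i) * (\<Prod>i\<in>-S. ?d \<pi> i)))"
      by (rule sum.mono_neutral_right)
        (use permutes_UNIV_fixing_iff[of _ S] in \<open>auto simp: diag\<close>)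
    also have "\<dots> = (\<Sum>\<pi> | \<pi> permutes S. (-1) ^ card S * lam ^ card (-S)
        * (of_int (sign \<pi>) * (\<Prod>i\<in>S. A $ i $ \<pi> i)))"
      by (rule sum.cong) (auto simp: diag prod_uminus permutes_not_in)
    finally show ?thesis
      by (simp add: principal_minor_def sum_distrib_left mult_ac Compl_eq_Diff_UNIV card_Diff_subset)
  qed
  have "Determinants.det (Finite_Cartesian_Product.mat lam - A)
      = (\<Sum>\<pi>\<in>?P. \<Sum>S\<in>UNIV. of_int (sign \<pi>) * ((\<Prod>i\<in>S. - A $ i $ \<pi> i) * (\<Prod>i\<in>-S. ?d \<pi> i)))"
    by (simp only: Determinants.det_def expand sum_distrib_left)
  also have "\<dots> = (\<Sum>S\<in>UNIV. (-1) ^ card S * principal_minor A S * lam ^ (CARD('n) - card S))"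
    by (subst sum.swap) (simp only: inner)
  also have "\<dots> = (\<Sum>k=0..CARD('n). \<Sum>S | S \<in> UNIV \<and> card S = k.
      (-1) ^ card S * principal_minor A S * lam ^ (CARD('n) - card S))"
    by (rule sum.group[symmetric]) (auto simp: card_mono)
  also have "\<dots> = (\<Sum>k=0..CARD('n). (-1) ^ k * sum_minors k A * lam ^ (CARD('n) - k))"
    by (intro sum.cong refl) (auto simp: sum_minors_def sum_distrib_left sum_distrib_right)
  finally show ?thesis .
qed

section \<open>Determinants in natural-number indices and in an arbitrary basis\<close>

lemma det_reindex:
  fixes A :: "real^'n^'n"
  assumes h: "bij_betw h {0..<n} (UNIV :: 'n set)"
  shows "Determinant.det (Matrix.mat n n (\<lambda>(i, j). A $ h i $ h j)) = Determinants.det A"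
proof -
  let ?m = "map_permutation {0..<n} h"
  have inj: "inj_on h {0..<n}" and im: "h ` {0..<n} = UNIV"
    using h by (auto simp: bij_betw_def)
  \<comment> \<open>Conjugation by \<open>h\<close> carries permutations of indices below
    \<open>n\<close> to permutations of the index type, and it preserves the sign.\<close>
  have bij: "bij_betw ?m {\<pi>. \<pi> permutes {0..<n}} {\<pi>. \<pi> permutes UNIV}"
    using bij_betw_permutations[OF h]
    by (rule bij_betw_cong[THEN iffD1, rotated])
      (auto simp: map_permutation_def restrict_id_def fun_eq_iff im)
  have "Determinants.det A
      = (\<Sum>\<pi> | \<pi> permutes {0..<n}. of_int (sign (?m \<pi>)) * (\<Prod>i\<in>UNIV. A $ i $ ?m \<pi> i))"
    unfolding Determinants.det_def by (rule sum.reindex_bij_betw[OF bij, symmetric])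
  also have "\<dots> = (\<Sum>\<pi> | \<pi> permutes {0..<n}. of_int (sign \<pi>) * (\<Prod>i=0..<n. A $ h i $ h (\<pi> i)))"
  proof (intro sum.cong refl)
    fix \<pi> assume "\<pi> \<in> {\<pi>. \<pi> permutes {0..<n}}"
    then have \<pi>: "\<pi> permutes {0..<n}"
      by simp
    have "(\<Prod>i\<in>UNIV. A $ i $ ?m \<pi> i) = (\<Prod>i=0..<n. A $ h i $ ?m \<pi> (h i))"
      by (rule prod.reindex_bij_betw[OF h, symmetric])
    also have "\<dots> = (\<Prod>i=0..<n. A $ h i $ h (\<pi> i))"
      by (intro prod.cong refl) (simp add: map_permutation_apply[OF inj])
    finally show "of_int (sign (?m \<pi>)) * (\<Prod>i\<in>UNIV. A $ i $ ?m \<pi> i)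
        = of_int (sign \<pi>) * (\<Prod>i=0..<n. A $ h i $ h (\<pi> i))"
      by (simp add: sign_map_permutation[OF inj \<pi>])
  qed
  also have "\<dots> = Determinant.det (Matrix.mat n n (\<lambda>(i, j). A $ h i $ h j))"
    by (subst Determinant.det_def'[of _ n]) (auto intro!: sum.cong prod.cong dest: permutes_in_image)
  finally show ?thesis ..
qed

lemma sum_representation_nth:
  assumes "ordered_basis V vs" "x \<in> V"
  shows "(\<Sum>k<length vs. representation (set vs) x (vs ! k) *\<^sub>R (vs ! k)) = x"
proof -
  have "(\<Sum>k<length vs. representation (set vs) x (vs ! k) *\<^sub>R (vs ! k))
      = (\<Sum>v\<in>set vs. representation (set vs) x v *\<^sub>R v)"
    using assms
    by (intro sum.reindex_bij_betw bij_betw_nth) (auto simp: ordered_basis_def)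
  then show ?thesis
    using assms by (simp add: ordered_basis_def real_vector.sum_representation_eq)
qed

lemma ordered_basis_UNIV_length:
  fixes vs :: "(real^'n) list"
  assumes "ordered_basis UNIV vs"
  shows "length vs = CARD('n)"
proof -
  have vs: "distinct vs" "independent (set vs)" "span (set vs) = UNIV"
    using assms by (auto simp: ordered_basis_def)
  have "length vs = dim (set vs)"
    using vs(1,2) by (simp add: dim_eq_card_independent distinct_card)
  also have "dim (set vs) = dim (UNIV :: (real^'n) set)"
    by (metis dim_span vs(3))
  finally show ?thesis
    by simp
qed

text \<open>Similar matrices have equal determinants. The columns of \<open>P\<close> are the basis
  vectors in standard coordinates, those of \<open>Q\<close> the standard vectors in coordinates
  with respect to \<open>vs\<close>, and \<open>T\<close> is \<open>A\<close> itself renumbered by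
  \<open>h\<close>.\<close>

lemma det_coord_matrix:
  fixes A :: "real^'n^'n"
  assumes vs: "ordered_basis UNIV vs"
  shows "Determinant.det (coord_matrix vs ((*v) A)) = Determinants.det A"
proof -
  let ?n = "CARD('n)"
  let ?r = "representation (set vs)"
  have len: "length vs = ?n"
    by (rule ordered_basis_UNIV_length[OF vs])
  obtain h where h: "bij_betw h {0..<?n} (UNIV :: 'n set)"
    using ex_bij_betw_nat_finite[OF finite_class.finite_UNIV] by blast
  define T where "T = Matrix.mat ?n ?n (\<lambda>(i, j). A $ h i $ h j)"
  define P where "P = Matrix.mat ?n ?n (\<lambda>(i, j). (vs ! j) $ h i)"
  define Q where "Q = Matrix.mat ?n ?n (\<lambda>(i, j). ?r (axis (h j) 1) (vs ! i))"
  define C where "C = coord_matrix vs ((*v) A)"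
  have car: "T \<in> carrier_mat ?n ?n" "P \<in> carrier_mat ?n ?n" "Q \<in> carrier_mat ?n ?n"
      "C \<in> carrier_mat ?n ?n"
    by (auto simp: T_def P_def Q_def C_def coord_matrix_def len)
  have expand: "(\<Sum>k<?n. (vs ! k) $ i * ?r x (vs ! k)) = x $ i" for x i
    using arg_cong[OF sum_representation_nth[OF vs UNIV_I, of x], of "\<lambda>v. v $ i"]
    by (simp add: len mult.commute)
  have "P * Q = 1\<^sub>m ?n"
  proof (rule eq_matI)
    fix i j assume ij: "i < dim_row (1\<^sub>m ?n :: real mat)" "j < dim_col (1\<^sub>m ?n :: real mat)"
    then have "(P * Q) $$ (i, j) = (\<Sum>k<?n. (vs ! k) $ h i * ?r (axis (h j) 1) (vs ! k))"
      by (simp add: P_def Q_def scalar_prod_def lessThan_atLeast0)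
    also have "\<dots> = axis (h j) 1 $ h i"
      by (rule expand)
    also have "\<dots> = 1\<^sub>m ?n $$ (i, j)"
      using ij h by (auto simp: axis_def bij_betw_def inj_on_eq_iff)
    finally show "(P * Q) $$ (i, j) = 1\<^sub>m ?n $$ (i, j)" .
  qed (use car in auto)
  then have "Determinant.det P * Determinant.det Q = 1"
    using det_mult[OF car(2,3)] by simp
  then have nz: "Determinant.det P \<noteq> 0"
    by auto
  \<comment> \<open>Column \<open>j\<close> of both sides is the image of \<open>vs ! j\<close> in
    standard coordinates; cancelling the nonzero \<open>det P\<close> then finishes the
    proof.\<close>
  have "P * C = T * P"
  proof (rule eq_matI)
    fix i j assume "i < dim_row (T * P)" "j < dim_col (T * P)"
    then have ij: "i < ?n" "j < ?n"
      using car by auto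
    have "(P * C) $$ (i, j) = (\<Sum>k<?n. (vs ! k) $ h i * ?r (A *v (vs ! j)) (vs ! k))"
      using ij by (simp add: P_def C_def coord_matrix_def len scalar_prod_def lessThan_atLeast0)
    also have "\<dots> = (A *v (vs ! j)) $ h i"
      by (rule expand)
    also have "\<dots> = (\<Sum>k=0..<?n. A $ h i $ h k * (vs ! j) $ h k)"
      by (simp add: matrix_vector_mult_def sum.reindex_bij_betw[OF h, symmetric])
    also have "\<dots> = (T * P) $$ (i, j)"
      using ij by (simp add: P_def T_def scalar_prod_def)
    finally show "(P * C) $$ (i, j) = (T * P) $$ (i, j)" .
  qed (use car in auto)
  then have "Determinant.det P * Determinant.det C = Determinant.det T * Determinant.det P"
    by (simp only: det_mult[OF car(2,4), symmetric] det_mult[OF car(1,2), symmetric])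
  then show ?thesis
    using nz det_reindex[OF h, of A] unfolding T_def[symmetric] C_def[symmetric]
    by (metis mult.commute mult_cancel_left)
qed

section \<open>The derivative of a determinant, and its value on block matrices\<close>

definition replace_row :: "'a mat \<Rightarrow> 'a mat \<Rightarrow> nat \<Rightarrow> 'a mat" where
  "replace_row A H k = Matrix.mat (dim_row A) (dim_col A)
     (\<lambda>(i, j). if i = k then H $$ (i, j) else A $$ (i, j))"

lemma replace_row_carrier [simp]:
  "A \<in> carrier_mat n n \<Longrightarrow> replace_row A H k \<in> carrier_mat n n"
  by (auto simp: replace_row_def)

text \<open>Expand along the replaced row: its cofactors are still those of \<open>A\<close>, and
  pairing them with \<open>H\<close> gives the diagonal entries of \<open>adj_mat A * H\<close>.
  This turns traces of adjugates into determinants, without inverting \<open>A\<close>.\<close>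

lemma sum_det_replace_row:
  fixes A H :: "real mat"
  assumes A: "A \<in> carrier_mat n n" and H: "H \<in> carrier_mat n n"
  shows "(\<Sum>k<n. Determinant.det (replace_row A H k)) = mat_trace (adj_mat A * H)"
proof -
  have cof: "cofactor (replace_row A H k) k j = cofactor A k j" if "k < n" "j < n" for k j
  proof -
    have "mat_delete (replace_row A H k) k j = mat_delete A k j"
      using A that by (intro eq_matI) (auto simp: mat_delete_def replace_row_def)
    then show ?thesis
      by (simp add: cofactor_def)
  qed
  have "Determinant.det (replace_row A H k) = (\<Sum>j<n. H $$ (k, j) * cofactor A k j)" if "k < n" for k
    using A that
    by (subst laplace_expansion_row[of _ n k]) (auto simp: cof intro!: sum.cong, auto simp: replace_row_def)
  then have "(\<Sum>k<n. Determinant.det (replace_row A H k))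
      = (\<Sum>k<n. \<Sum>j<n. H $$ (k, j) * cofactor A k j)"
    by simp
  also have "\<dots> = (\<Sum>j<n. \<Sum>k<n. cofactor A k j * H $$ (k, j))"
    by (subst sum.swap) (simp add: mult.commute)
  also have "\<dots> = mat_trace (adj_mat A * H)"
    using A H by (auto simp: mat_trace_def adj_mat_def scalar_prod_def lessThan_atLeast0 intro!: sum.cong)
  finally show ?thesis .
qed

text \<open>Jacobi's formula. The product rule differentiates one factor of each Leibniz term, that
  is, one row at a time; exchanging the sums over rows and permutations collects determinants with
  one row of \<open>A z\<close> replaced.\<close>

lemma det_has_field_derivative:
  fixes A :: "real \<Rightarrow> real mat"
  assumes A: "\<And>s. A s \<in> carrier_mat n n" and H: "H \<in> carrier_mat n n"
    and deriv: "\<And>i j. i < n \<Longrightarrow> j < n \<Longrightarrow> ((\<lambda>s. A s $$ (i, j)) has_field_derivative H $$ (i, j)) (at z)"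
  shows "((\<lambda>s. Determinant.det (A s)) has_field_derivative mat_trace (adj_mat (A z) * H)) (at z)"
proof -
  let ?P = "{\<pi>. \<pi> permutes {0..<n}}"
  have row: "Determinant.det (replace_row (A z) H k)
      = (\<Sum>\<pi>\<in>?P. of_int (sign \<pi>) * (H $$ (k, \<pi> k) * (\<Prod>i\<in>{0..<n}-{k}. A z $$ (i, \<pi> i))))"
    if k: "k < n" for k
    unfolding det_def'[OF replace_row_carrier[OF A]]
  proof (intro sum.cong refl)
    fix \<pi> assume "\<pi> \<in> ?P"
    then have \<pi>: "\<pi> i < n" if "i < n" for i
      using that permutes_in_image[of \<pi> "{0..<n}" i] by simp
    have "(\<Prod>i=0..<n. replace_row (A z) H k $$ (i, \<pi> i))
        = (\<Prod>i=0..<n. if i = k then H $$ (k, \<pi> k) else A z $$ (i, \<pi> i))"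
      using A[of z] \<pi> by (intro prod.cong) (auto simp: replace_row_def)
    also have "\<dots> = H $$ (k, \<pi> k) * (\<Prod>i\<in>{0..<n}-{k}. A z $$ (i, \<pi> i))"
      using k by (subst prod.remove[of _ k]) (auto intro!: prod.cong)
    finally show "of_int (sign \<pi>) * (\<Prod>i=0..<n. replace_row (A z) H k $$ (i, \<pi> i))
        = of_int (sign \<pi>) * (H $$ (k, \<pi> k) * (\<Prod>i\<in>{0..<n}-{k}. A z $$ (i, \<pi> i)))"
      by simp
  qed
  have "((\<lambda>s. \<Sum>\<pi>\<in>?P. of_int (sign \<pi>) * (\<Prod>i=0..<n. A s $$ (i, \<pi> i))) has_field_derivative
      (\<Sum>\<pi>\<in>?P. of_int (sign \<pi>) * (\<Sum>k=0..<n. H $$ (k, \<pi> k) * (\<Prod>i\<in>{0..<n}-{k}. A z $$ (i, \<pi> i)))))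
      (at z)"
    by (intro DERIV_sum DERIV_cmult has_field_derivative_prod deriv) (auto dest: permutes_in_image)
  also have "(\<lambda>s. \<Sum>\<pi>\<in>?P. of_int (sign \<pi>) * (\<Prod>i=0..<n. A s $$ (i, \<pi> i))) = (\<lambda>s. Determinant.det (A s))"
    by (simp add: det_def'[OF A])
  also have "(\<Sum>\<pi>\<in>?P. of_int (sign \<pi>) * (\<Sum>k=0..<n. H $$ (k, \<pi> k) * (\<Prod>i\<in>{0..<n}-{k}. A z $$ (i, \<pi> i))))
      = (\<Sum>k<n. Determinant.det (replace_row (A z) H k))"
    by (simp add: row sum_distrib_left lessThan_atLeast0 sum.swap[of _ ?P])
  finally show ?thesis
    by (simp only: sum_det_replace_row[OF A H])
qed

text \<open>Replacing a row of a block diagonal matrix leaves it block triangular, so its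
  determinant is the product of the two diagonal blocks' determinants. A row in the upper half can
  bring in \<open>H2\<close> and a row in the lower half \<open>H3\<close>, but neither block
  affects that product.\<close>

lemma trace_adj_four_block:
  fixes A D :: "real mat"
  assumes A: "A \<in> carrier_mat m m" and D: "D \<in> carrier_mat l l"
    and H1: "H1 \<in> carrier_mat m m" and H2: "H2 \<in> carrier_mat m l"
    and H3: "H3 \<in> carrier_mat l m" and H4: "H4 \<in> carrier_mat l l"
  shows "mat_trace (adj_mat (four_block_mat A (0\<^sub>m m l) (0\<^sub>m l m) D) * four_block_mat H1 H2 H3 H4)
       = mat_trace (adj_mat A * H1) * Determinant.det D
         + Determinant.det A * mat_trace (adj_mat D * H4)"
proof -
  let ?B = "four_block_mat A (0\<^sub>m m l) (0\<^sub>m l m) D" and ?H = "four_block_mat H1 H2 H3 H4"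
  have B: "?B \<in> carrier_mat (m + l) (m + l)" and H: "?H \<in> carrier_mat (m + l) (m + l)"
    using A D H1 H4 by auto
  have upper: "Determinant.det (replace_row ?B ?H k) = Determinant.det (replace_row A H1 k) * Determinant.det D"
    if "k < m" for k
  proof -
    have "replace_row ?B ?H k = four_block_mat (replace_row A H1 k)
        (Matrix.mat m l (\<lambda>(i, j). if i = k then H2 $$ (i, j) else 0)) (0\<^sub>m l m) D"
      using A D H1 H2 H3 H4 that by (intro eq_matI) (auto simp: replace_row_def)
    then show ?thesis
      using A D by (simp add: det_four_block_mat_lower_left_zero[of _ m _ l])
  qed
  have lower: "Determinant.det (replace_row ?B ?H (m + k))
      = Determinant.det A * Determinant.det (replace_row D H4 k)" if "k < l" for k
  proof -
    have "replace_row ?B ?H (m + k) = four_block_mat A (0\<^sub>m m l)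
        (Matrix.mat l m (\<lambda>(i, j). if i = k then H3 $$ (i, j) else 0)) (replace_row D H4 k)"
      using A D H1 H2 H3 H4 that by (intro eq_matI) (auto simp: replace_row_def)
    then show ?thesis
      using A D by (simp add: det_four_block_mat_upper_right_zero[of _ m _ l])
  qed
  have split: "(\<Sum>k<m + n. f k) = (\<Sum>k<m. f k) + (\<Sum>k<n. f (m + k))" for f :: "nat \<Rightarrow> real" and n
    by (induction n) auto
  have "(\<Sum>k<m + l. Determinant.det (replace_row ?B ?H k))
      = (\<Sum>k<m. Determinant.det (replace_row ?B ?H k)) + (\<Sum>k<l. Determinant.det (replace_row ?B ?H (m + k)))"
    by (rule split)
  also have "\<dots> = (\<Sum>k<m. Determinant.det (replace_row A H1 k)) * Determinant.det D
      + Determinant.det A * (\<Sum>k<l. Determinant.det (replace_row D H4 k))"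
    by (simp add: upper lower sum_distrib_left sum_distrib_right)
  finally show ?thesis
    by (simp only: sum_det_replace_row[OF A H1] sum_det_replace_row[OF D H4] sum_det_replace_row[OF B H])
qed

lemma det_2x2:
  fixes A :: "real mat"
  assumes A: "A \<in> carrier_mat 2 2"
  shows "Determinant.det A = A $$ (0, 0) * A $$ (1, 1) - A $$ (0, 1) * A $$ (1, 0)"
proof -
  have "Determinant.det (mat_delete A 0 j) = A $$ (1, if j = 0 then 1 else 0)" if "j < 2" for j
    using A that by (subst det_single) (auto simp: mat_delete_def)
  then have "cofactor A 0 0 = A $$ (1, 1)" "cofactor A 0 1 = - A $$ (1, 0)"
    by (simp_all add: cofactor_def)
  then show ?thesis
    using laplace_expansion_row[OF A, of 0] by (simp add: lessThan_Suc numeral_2_eq_2)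
qed

section \<open>Derivatives of the Jacobian and of its minors along a line\<close>

lemma has_vector_derivative_cart:
  fixes F :: "real \<Rightarrow> 'a::euclidean_space ^ 'n"
  assumes "\<And>i. ((\<lambda>s. F s $ i) has_vector_derivative D $ i) (at z)"
  shows "(F has_vector_derivative D) (at z)"
  unfolding has_vector_derivative_def
proof (subst has_derivative_componentwise_within, intro ballI)
  fix b :: "'a ^ 'n" assume "b \<in> Basis"
  then obtain i c where b: "b = axis i c" "c \<in> Basis"
    by (auto simp: Basis_vec_def)
  show "((\<lambda>s. F s \<bullet> b) has_derivative (\<lambda>h. (h *\<^sub>R D) \<bullet> b)) (at z)"
    using has_derivative_inner_left[OF assms[of i, unfolded has_vector_derivative_def], of c]
    by (simp add: b inner_axis)
qed

text \<open>The sums of minors are polynomials in the entries. Differentiability ensures that the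
  value of \<open>deriv\<close> is a genuine derivative.\<close>

lemma sum_minors_differentiable:
  assumes "\<And>i j. ((\<lambda>s. F s $ i $ j) has_field_derivative D $ i $ j) (at z)"
  shows "((\<lambda>s. sum_minors k (F s)) has_field_derivative deriv (\<lambda>s. sum_minors k (F s)) z) (at z)"
proof -
  have "((\<lambda>s. sum_minors k (F s)) has_field_derivative
      (\<Sum>S | S \<subseteq> UNIV \<and> card S = k. \<Sum>\<pi> | \<pi> permutes S. of_int (sign \<pi>) *
        (\<Sum>i\<in>S. D $ i $ \<pi> i * (\<Prod>j\<in>S - {i}. F z $ j $ \<pi> j)))) (at z)"
    unfolding sum_minors_def principal_minor_def
    by (intro DERIV_sum DERIV_cmult has_field_derivative_prod assms)
  then show ?thesis
    by (simp add: DERIV_imp_deriv)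
qed

text \<open>On \<open>U\<close> the choice-based derivatives agree with the witnesses of
  \<open>C2_on\<close>, so the chain rule along the line applies to \<open>f'\<close>. Passing from
  a linear map to a matrix entry is bounded linear and commutes with differentiation.\<close>

lemma C2_on_jacobian:
  fixes X :: "real^'n \<Rightarrow> real^'n"
  assumes "C2_on X U" "open U" "p \<in> U"
  shows "linear (second_derivative X p q)"
    and "((\<lambda>s. jacobian X (at (p + s *\<^sub>R q))) has_vector_derivative
          matrix (second_derivative X p q)) (at 0)"
proof -
  obtain f' f'' where f': "\<And>x. x \<in> U \<Longrightarrow> (X has_derivative blinfun_apply (f' x)) (at x)"
    and f'': "\<And>x. x \<in> U \<Longrightarrow> (f' has_derivative blinfun_apply (f'' x)) (at x)"
    using assms(1) unfolding C2_on_def by blast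
  have frechet: "frechet_derivative X (at x) = blinfun_apply (f' x)" if "x \<in> U" for x
    using frechet_derivative_at[OF f'[OF that]] by simp
  have sd: "second_derivative X p u v = f'' p u v" for u v
  proof -
    have "((\<lambda>x. blinfun_apply (f' x) v) has_derivative (\<lambda>u. f'' p u v)) (at p)"
      by (rule bounded_linear.has_derivative[OF blinfun.bounded_linear_left f''[OF assms(3)]])
    then have "((\<lambda>x. frechet_derivative X (at x) v) has_derivative (\<lambda>u. f'' p u v)) (at p)"
      by (rule has_derivative_transform_within_open[OF _ assms(2,3)]) (simp add: frechet)
    from fun_cong[OF frechet_derivative_at[OF this], of u] show ?thesis
      by (simp add: second_derivative_def)
  qed
  then have "second_derivative X p q = blinfun_apply (f'' p q)"
    by (rule ext)
  then show "linear (second_derivative X p q)"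
    by (simp add: blinfun.bounded_linear_right bounded_linear.linear)
  have line: "((\<lambda>s. f' (p + s *\<^sub>R q)) has_vector_derivative f'' p q) (at 0)"
  proof -
    have "((\<lambda>s. p + s *\<^sub>R q) has_derivative (\<lambda>s. s *\<^sub>R q)) (at 0)"
      by (auto intro!: derivative_eq_intros)
    from has_derivative_compose[OF this, of f' "blinfun_apply (f'' p)"] show ?thesis
      using f''[OF assms(3)] by (simp add: has_vector_derivative_def blinfun.scaleR_right)
  qed
  have "open ((\<lambda>s. p + s *\<^sub>R q) -` U)"
    by (intro open_vimage assms continuous_intros)
  \<comment> \<open>The Jacobian is identified with the matrix of \<open>f'\<close> only inside
    \<open>U\<close>; agreement near \<open>s = 0\<close> suffices to transfer the
    derivative.\<close>
  then have near: "eventually (\<lambda>s. p + s *\<^sub>R q \<in> U) (nhds 0)"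
    using assms(3) by (auto simp: eventually_nhds)
  have "((\<lambda>s. matrix (blinfun_apply (f' (p + s *\<^sub>R q)))) has_vector_derivative
      matrix (second_derivative X p q)) (at 0)"
  proof (intro has_vector_derivative_cart)
    fix i j
    have "bounded_linear (\<lambda>T :: (real^'n) \<Rightarrow>\<^sub>L (real^'n). blinfun_apply T (axis j 1) $ i :: real)"
      by (intro bounded_linear_compose[OF bounded_linear_vec_nth] blinfun.bounded_linear_left)
    from bounded_linear.has_vector_derivative[OF this line]
    show "((\<lambda>s. matrix (blinfun_apply (f' (p + s *\<^sub>R q))) $ i $ j) has_vector_derivative
        matrix (second_derivative X p q) $ i $ j) (at 0)"
      by (simp add: matrix_def sd)
  qed
  then show "((\<lambda>s. jacobian X (at (p + s *\<^sub>R q))) has_vector_derivative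
      matrix (second_derivative X p q)) (at 0)"
    by (rule has_vector_derivative_cong_ev[THEN iffD1, rotated 2])
      (use near assms(3) in \<open>auto simp: jacobian_def frechet elim: eventually_mono\<close>)
qed

section \<open>The splitting into center and transverse space\<close>

locale BT_splitting =
  fixes J :: "real^'n^'n" and q0 q1 :: "real^'n" and p0 p1 :: "real^'n \<Rightarrow> real"
  assumes kernel: "{x. J *v x = 0} = span {q0}"
    and J_q1: "J *v q1 = q0"
    and linear_p0: "linear p0" and linear_p1: "linear p1"
    and p_q: "p0 q0 = 1" "p1 q1 = 1" "p0 q1 = 0" "p1 q0 = 0"
    and p_transverse: "\<And>x. x \<in> transverse_space J \<Longrightarrow> p0 x = 0" "\<And>x. x \<in> transverse_space J \<Longrightarrow> p1 x = 0"
begin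

lemmas p_linear = linear_add[OF linear_p0] linear_diff[OF linear_p0] linear_cmul[OF linear_p0]
  linear_neg[OF linear_p0] linear_add[OF linear_p1] linear_diff[OF linear_p1] linear_cmul[OF linear_p1]
  linear_neg[OF linear_p1] linear_0[OF linear_p0] linear_0[OF linear_p1]

lemma J_q0: "J *v q0 = 0"
  using kernel span_base[of q0 "{q0}"] by blast

lemma subspace_transverse: "subspace (transverse_space J)"
  unfolding transverse_space_def
  by (intro linear_subspace_image matrix_vector_mul_linear subspace_UNIV)

lemma J_transverse: "x \<in> transverse_space J \<Longrightarrow> J *v x \<in> transverse_space J"
  unfolding transverse_space_def
  by (auto simp: matrix_vector_mul_assoc matrix_mul_assoc) (metis matrix_mul_assoc matrix_vector_mul_assoc rangeI)

text \<open>If \<open>J *v x\<close> lies in the kernel, it is a multiple \<beta> of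
  \<open>q0 = J *v q1\<close>, so x - \<beta> \<open>q1\<close> lies in the kernel too and is a
  multiple of \<open>q0\<close>. The covectors, being dual to \<open>q0\<close>, \<open>q1\<close>,
  read off both coefficients.\<close>

lemma center_space_iff: "x \<in> center_space J \<longleftrightarrow> x = p0 x *\<^sub>R q0 + p1 x *\<^sub>R q1"
proof
  assume "x \<in> center_space J"
  then have "J *v x \<in> span {q0}"
    by (simp add: center_space_def flip: matrix_vector_mul_assoc kernel)
  then obtain \<beta> where "J *v x = \<beta> *\<^sub>R q0"
    by (auto simp: span_singleton)
  then have "J *v (x - \<beta> *\<^sub>R q1) = 0"
    by (simp add: matrix_vector_mult_diff_distrib J_q1 matrix_vector_mult_scaleR)
  then have "x - \<beta> *\<^sub>R q1 \<in> span {q0}"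
    using kernel by blast
  then obtain \<alpha> where "x - \<beta> *\<^sub>R q1 = \<alpha> *\<^sub>R q0"
    by (auto simp: span_singleton)
  then have "x = \<alpha> *\<^sub>R q0 + \<beta> *\<^sub>R q1"
    by (simp add: algebra_simps)
  then show "x = p0 x *\<^sub>R q0 + p1 x *\<^sub>R q1"
    by (simp add: p_linear p_q)
next
  assume "x = p0 x *\<^sub>R q0 + p1 x *\<^sub>R q1"
  then have "J *v (J *v x) = J *v (J *v (p0 x *\<^sub>R q0 + p1 x *\<^sub>R q1))"
    by simp
  then show "x \<in> center_space J"
    by (simp add: center_space_def matrix_vector_mul_assoc[symmetric] matrix_vector_right_distrib
        matrix_vector_mult_scaleR J_q0 J_q1)
qed

text \<open>A center vector is determined by its values under \<open>p0\<close> and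
  \<open>p1\<close>, and both covectors vanish on the transverse space.\<close>

lemma center_transverse_zero: "x \<in> center_space J \<Longrightarrow> x \<in> transverse_space J \<Longrightarrow> x = 0"
  using center_space_iff[of x] p_transverse[of x] by simp

text \<open>The square of \<open>J\<close> maps its image into itself, injectively because the
  kernel meets the image only in 0; equal dimensions give surjectivity. This is what makes the two
  subspaces span everything.\<close>

lemma square_image_transverse: "(*v) (J ** J) ` transverse_space J = transverse_space J"
proof (rule subspace_dim_equal)
  have "inj_on ((*v) (J ** J)) (transverse_space J)"
  proof (rule inj_onI)
    fix x y assume xy: "x \<in> transverse_space J" "y \<in> transverse_space J" "(J ** J) *v x = (J ** J) *v y"
    then have "x - y \<in> center_space J"
      by (simp add: center_space_def matrix_vector_mult_diff_distrib)
    moreover have "x - y \<in> transverse_space J"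
      using xy subspace_transverse by (simp add: subspace_diff)
    ultimately show "x = y"
      using center_transverse_zero by fastforce
  qed
  then have "dim ((*v) (J ** J) ` transverse_space J) = dim (transverse_space J)"
    by (intro dim_image_eq) (simp_all add: span_eq_iff[THEN iffD2, OF subspace_transverse])
  then show "dim (transverse_space J) \<le> dim ((*v) (J ** J) ` transverse_space J)"
    by simp
qed (auto intro!: linear_subspace_image subspace_transverse simp: transverse_space_def)

lemma transverse_proj_unique:
  assumes "y \<in> transverse_space J" "x - y \<in> center_space J"
  shows "transverse_proj J x = y"
  unfolding transverse_proj_def
proof (rule the_equality)
  fix z assume z: "z \<in> transverse_space J \<and> x - z \<in> center_space J"
  have "y - z \<in> transverse_space J"
    using assms z subspace_transverse by (simp add: subspace_diff)
  moreover have "y - z \<in> center_space J"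
    using assms z by (simp add: center_space_def matrix_vector_mult_diff_distrib)
  ultimately show "z = y"
    using center_transverse_zero by fastforce
qed (use assms in simp)

text \<open>Some transverse \<open>y\<close> has the same image as \<open>x\<close> under the square
  of \<open>J\<close>, so \<open>x - y\<close> is a center vector and its coordinates are known. The
  explicit formula makes the projection visibly linear.\<close>

lemma transverse_proj:
  "transverse_proj J x = x - p0 x *\<^sub>R q0 - p1 x *\<^sub>R q1" "transverse_proj J x \<in> transverse_space J"
proof -
  have "(J ** J) *v x \<in> (*v) (J ** J) ` transverse_space J"
    by (simp only: square_image_transverse) (simp add: transverse_space_def)
  then obtain y where y: "y \<in> transverse_space J" "x - y \<in> center_space J"
    by (auto simp: center_space_def matrix_vector_mult_diff_distrib)
  then have "transverse_proj J x = y"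
    by (rule transverse_proj_unique)
  moreover have "x - y = p0 x *\<^sub>R q0 + p1 x *\<^sub>R q1"
    using y p_transverse[of y] center_space_iff[of "x - y"] by (simp add: p_linear)
  ultimately show "transverse_proj J x = x - p0 x *\<^sub>R q0 - p1 x *\<^sub>R q1"
      "transverse_proj J x \<in> transverse_space J"
    using y by (auto simp: algebra_simps)
qed

section \<open>Block matrices in the basis \<open>q0 # q1 # bs\<close>\<close>

context
  fixes bs
  assumes bs: "ordered_basis (transverse_space J) bs"
begin

lemma span_bs: "span (set bs) = transverse_space J" "x \<in> set bs \<Longrightarrow> x \<in> transverse_space J"
  using bs span_base[of x "set bs"] by (auto simp: ordered_basis_def)

lemma q_notin_span: "q1 \<notin> span (set bs)" "q0 \<notin> span (insert q1 (set bs))"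
proof -
  show "q1 \<notin> span (set bs)"
    using p_q p_transverse by (auto simp: span_bs)
  show "q0 \<notin> span (insert q1 (set bs))"
  proof
    assume "q0 \<in> span (insert q1 (set bs))"
    then obtain k where "q0 - k *\<^sub>R q1 \<in> transverse_space J"
      by (auto simp: span_breakdown_eq span_bs)
    from p_transverse(1)[OF this] show False
      by (simp add: p_linear p_q)
  qed
qed

lemma q_distinct: "q1 \<notin> set bs" "q0 \<notin> set bs" "q0 \<noteq> q1"
  using q_notin_span by (auto intro: span_base)

lemma extended_basis: "ordered_basis UNIV (q0 # q1 # bs)"
proof -
  have "x \<in> span (set (q0 # q1 # bs))" for x
  proof -
    have "transverse_proj J x \<in> span (insert q0 (insert q1 (set bs)))"
      using transverse_proj(2)[of x] span_mono[of "set bs" "insert q0 (insert q1 (set bs))"]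
      by (auto simp: span_bs)
    then have "transverse_proj J x + p0 x *\<^sub>R q0 + p1 x *\<^sub>R q1 \<in> span (insert q0 (insert q1 (set bs)))"
      by (intro span_add span_scale) (auto intro: span_base)
    then show ?thesis
      by (simp add: transverse_proj)
  qed
  then show ?thesis
    using bs q_notin_span q_distinct by (auto simp: ordered_basis_def independent_insert)
qed

text \<open>Split \<open>x\<close> into its center and transverse parts: \<open>p0\<close> and
  \<open>p1\<close> give the first two coordinates, and the transverse part has the same coordinates
  in \<open>bs\<close> as in the larger basis.\<close>

lemma representation_extended:
  "representation (set (q0 # q1 # bs)) x v
   = (if v = q0 then p0 x else if v = q1 then p1 x else representation (set bs) (transverse_proj J x) v)"
proof -
  define B where "B = set (q0 # q1 # bs)"
  have ind: "independent B" and sp: "y \<in> span B" for y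
    using extended_basis by (auto simp: ordered_basis_def B_def)
  have sub: "set bs \<subseteq> B" "q0 \<in> B" "q1 \<in> B"
    by (auto simp: B_def)
  have "representation B (transverse_proj J x) = representation (set bs) (transverse_proj J x)"
    using transverse_proj(2)[of x] by (intro real_vector.representation_extend[OF ind _ sub(1)]) (simp add: span_bs)
  moreover have "representation (set bs) (transverse_proj J x) q0 = 0"
      "representation (set bs) (transverse_proj J x) q1 = 0"
    using q_distinct real_vector.representation_ne_zero[of "set bs"] by auto
  moreover have "x = p0 x *\<^sub>R q0 + p1 x *\<^sub>R q1 + transverse_proj J x"
    by (simp add: transverse_proj)
  then have "representation B x v = representation B (p0 x *\<^sub>R q0 + p1 x *\<^sub>R q1 + transverse_proj J x) v"
    by simp
  ultimately show ?thesis
    using q_distinct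
    using real_vector.representation_basis[OF ind sub(2)] real_vector.representation_basis[OF ind sub(3)]
    by (simp add: B_def[symmetric] del: list.set, simp add: real_vector.representation_add[OF ind sp sp] real_vector.representation_scale[OF ind sp])
qed

text \<open>\<open>T\<close> is kept arbitrary because the blocks are needed both for \<lambda> I -
  J and for the derivative \<open>- L\<close>, which need not respect the splitting; hence the
  projection in the lower blocks.\<close>

lemma coord_matrix_extended:
  "coord_matrix (q0 # q1 # bs) T = four_block_mat
     (Matrix.mat 2 2 (\<lambda>(i, j). (if i = 0 then p0 else p1) (T (if j = 0 then q0 else q1))))
     (Matrix.mat 2 (length bs) (\<lambda>(i, j). (if i = 0 then p0 else p1) (T (bs ! j))))
     (Matrix.mat (length bs) 2 (\<lambda>(i, j).
        representation (set bs) (transverse_proj J (T (if j = 0 then q0 else q1))) (bs ! i)))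
     (coord_matrix bs (\<lambda>w. transverse_proj J (T w)))" (is "_ = ?F")
proof (rule eq_matI)
  \<comment> \<open>The vectors of \<open>bs\<close> sit two places further on, matching the size of
    the upper left block.\<close>
  have nth: "(q0 # q1 # bs) ! i = (if i = 0 then q0 else if i = 1 then q1 else bs ! (i - 2))" for i
    by (auto simp: nth_Cons numeral_2_eq_2 split: nat.split)
  have ne: "bs ! i \<noteq> q0" "bs ! i \<noteq> q1" if "i < length bs" for i
    using q_distinct nth_mem[OF that] by auto
  fix i j
  assume "i < dim_row ?F" "j < dim_col ?F"
  then have ij: "i < length bs + 2" "j < length bs + 2"
    by (auto simp: coord_matrix_def)
  then have "coord_matrix (q0 # q1 # bs) T $$ (i, j)
      = representation (set (q0 # q1 # bs)) (T ((q0 # q1 # bs) ! j)) ((q0 # q1 # bs) ! i)"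
    by (simp add: coord_matrix_def)
  also have "\<dots> = ?F $$ (i, j)"
    using ij ne[of "i - 2"] q_distinct unfolding representation_extended nth
    by (auto simp: coord_matrix_def)
  finally show "coord_matrix (q0 # q1 # bs) T $$ (i, j) = ?F $$ (i, j)" .
qed (auto simp: coord_matrix_def)

lemma coord_matrix_char:
  "coord_matrix (q0 # q1 # bs) ((*v) (Finite_Cartesian_Product.mat lam - J)) = four_block_mat
     (Matrix.mat 2 2 (\<lambda>(i, j). if i = j then lam else if i = 0 then -1 else 0))
     (0\<^sub>m 2 (length bs)) (0\<^sub>m (length bs) 2)
     (lam \<cdot>\<^sub>m 1\<^sub>m (length bs) - coord_matrix bs ((*v) J))"
proof -
  let ?T = "(*v) (Finite_Cartesian_Product.mat lam - J)"
  have T: "?T x = lam *\<^sub>R x - J *v x" for x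
  proof -
    have "Finite_Cartesian_Product.mat lam *v x = lam *\<^sub>R x"
      by (simp add: Finite_Cartesian_Product.vec_eq_iff matrix_vector_mult_def Finite_Cartesian_Product.mat_def if_distrib[of "\<lambda>a. a * b" for b] cong: if_cong)
    then show ?thesis
      by (simp add: matrix_vector_mult_diff_rdistrib)
  qed
  have T_transverse: "?T x \<in> transverse_space J" if "x \<in> transverse_space J" for x
    using that J_transverse subspace_transverse by (simp add: T subspace_diff subspace_scale)
  have proj: "transverse_proj J (?T x) = ?T x" if "x \<in> transverse_space J" for x
    using T_transverse[OF that] p_transverse by (simp add: transverse_proj)
  have ind: "independent (set bs)" and dist: "distinct bs"
    using bs by (auto simp: ordered_basis_def)
  have mem: "bs ! j \<in> transverse_space J" "bs ! j \<in> span (set bs)" if "j < length bs" for j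
    using that span_bs by auto
  have block11: "Matrix.mat 2 2 (\<lambda>(i, j). (if i = 0 then p0 else p1) (?T (if j = 0 then q0 else q1)))
      = Matrix.mat 2 2 (\<lambda>(i, j). if i = j then lam else if i = 0 then -1 else 0)"
    by (intro eq_matI) (auto simp: T J_q0 J_q1 p_linear p_q)
  have block12: "Matrix.mat 2 (length bs) (\<lambda>(i, j). (if i = 0 then p0 else p1) (?T (bs ! j)))
      = 0\<^sub>m 2 (length bs)"
    using p_transverse[OF T_transverse[OF mem(1)]] by (intro eq_matI) auto
  have block21: "Matrix.mat (length bs) 2 (\<lambda>(i, j).
      representation (set bs) (transverse_proj J (?T (if j = 0 then q0 else q1))) (bs ! i))
      = 0\<^sub>m (length bs) 2"
    by (intro eq_matI)
      (auto simp: T J_q0 J_q1 p_linear p_q transverse_proj real_vector.representation_zero)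
  have "representation (set bs) (transverse_proj J (?T (bs ! j))) (bs ! i)
      = (if i = j then lam else 0) - representation (set bs) (J *v (bs ! j)) (bs ! i)"
    if "i < length bs" "j < length bs" for i j
  proof -
    have "J *v (bs ! j) \<in> span (set bs)"
      using J_transverse[OF mem(1)[OF that(2)]] span_bs by simp
    then show ?thesis
      using that mem[OF that(2)] dist real_vector.representation_basis[OF ind, of "bs ! j"]
      unfolding proj[OF mem(1)[OF that(2)]]
      unfolding T
      by (simp add: real_vector.representation_diff[OF ind] real_vector.representation_scale[OF ind]
          span_scale nth_eq_iff_index_eq)
  qed
  then have block22: "coord_matrix bs (\<lambda>w. transverse_proj J (?T w))
      = lam \<cdot>\<^sub>m 1\<^sub>m (length bs) - coord_matrix bs ((*v) J)"
    by (intro eq_matI) (auto simp: coord_matrix_def)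
  show ?thesis
    by (simp only: coord_matrix_extended block11 block12 block21 block22)
qed

text \<open>The upper left block has determinant \<open>lam\<^sup>2\<close>, the factor of the
  transverse trace. Its entry -1 is what lets the lower left entry \<open>p1 (L *v q0)\<close>
  contribute, as the term without \<lambda>. The overall sign comes from \<open>- L\<close>.\<close>

lemma trace_adj_char:
  fixes lam :: real and L :: "real^'n^'n"
  defines "D \<equiv> lam \<cdot>\<^sub>m 1\<^sub>m (length bs) - coord_matrix bs ((*v) J)"
  shows "mat_trace (adj_mat (coord_matrix (q0 # q1 # bs) ((*v) (Finite_Cartesian_Product.mat lam - J)))
           * coord_matrix (q0 # q1 # bs) ((*v) (- L)))
       = - Determinant.det D * ((p0 (L *v q0) + p1 (L *v q1)) * lam + p1 (L *v q0))
         - lam\<^sup>2 * mat_trace (adj_mat D * coord_matrix bs (\<lambda>w. transverse_proj J (L *v w)))"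
proof -
  let ?A = "Matrix.mat 2 2 (\<lambda>(i, j). if i = j then lam else if i = 0 then -1 else 0)"
  let ?H = "Matrix.mat 2 2 (\<lambda>(i, j). (if i = 0 then p0 else p1) (- L *v (if j = 0 then q0 else q1)))"
  let ?K = "coord_matrix bs (\<lambda>w. transverse_proj J (L *v w))"
  have D: "D \<in> carrier_mat (length bs) (length bs)" and K: "?K \<in> carrier_mat (length bs) (length bs)"
    by (auto simp: D_def coord_matrix_def)
  have neg: "- L *v x = - (L *v x)" for x
    by (simp add: Finite_Cartesian_Product.vec_eq_iff matrix_vector_mult_def sum_negf)
  have ind: "independent (set bs)"
    using bs by (auto simp: ordered_basis_def)
  have "transverse_proj J (- x) = - transverse_proj J x" for x
    by (simp add: transverse_proj p_linear)
  then have K': "coord_matrix bs (\<lambda>w. transverse_proj J (- L *v w)) = - ?K"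
    using transverse_proj(2) span_bs
    by (intro eq_matI) (auto simp: coord_matrix_def neg real_vector.representation_neg[OF ind])
  have car: "- ?K \<in> carrier_mat (length bs) (length bs)"
    using K by simp
  have "adj_mat D * (- ?K) = - (adj_mat D * ?K)"
    using adj_mat(1)[OF D] K by (intro uminus_mult_right_mat) auto
  then have trace_K: "mat_trace (adj_mat D * (- ?K)) = - mat_trace (adj_mat D * ?K)"
    using K adj_mat(1)[OF D] by (simp add: mat_trace_def sum_negf)
  have "mat_trace (adj_mat ?A * ?H) = (\<Sum>k<2. Determinant.det (replace_row ?A ?H k))"
    by (rule sum_det_replace_row[symmetric]) auto
  also have "\<dots> = - ((p0 (L *v q0) + p1 (L *v q1)) * lam + p1 (L *v q0))"
    by (simp add: numeral_2_eq_2 lessThan_Suc det_2x2 replace_row_def neg p_linear algebra_simps)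
  finally have trace_A: "mat_trace (adj_mat ?A * ?H) = \<dots>" .
  have det_A: "Determinant.det ?A = lam\<^sup>2"
    by (simp add: det_2x2 power2_eq_square)
  show ?thesis
    unfolding coord_matrix_char
    unfolding coord_matrix_extended K' D_def[symmetric]
    by (subst trace_adj_four_block[OF _ D _ _ _ car])
      (simp_all add: trace_A det_A trace_K algebra_simps)
qed

end

end

section \<open>Comparison of the two derivatives of the characteristic polynomial\<close>

theorem theorem3p3:
  fixes X :: "real^'n \<Rightarrow> real^'n"
    and U :: "(real^'n) set"
    and p q0 :: "real^'n"
    and J L :: "real^'n^'n"
    and a b lam :: real
    and bs :: "(real^'n) list"
    and Jtr Ltr :: "real mat"
  assumes "CARD('n) \<ge> 2"
    and "open U"
    and "C2_on X U"
    and "p \<in> U"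
    and "X p = 0"
    and "J = jacobian X (at p)"
    and "rank J = CARD('n) - 1"
    and "sum_minors (CARD('n) - 1) J = 0"
    and "sum_minors (CARD('n) - 2) J \<noteq> 0"
    and "{x. J *v x = 0} = span {q0}"
    and "BT_coefficients X p q0 a b"
    and "L = vector_derivative (\<lambda>s. jacobian X (at (p + s *\<^sub>R q0))) (at 0)"
    and "ordered_basis (transverse_space J) bs"
    and "Jtr = coord_matrix bs (\<lambda>w. J *v w)"
    and "Ltr = coord_matrix bs (\<lambda>w. transverse_proj J (L *v w))"
  shows "(\<Sum>k=0..CARD('n). (-1) ^ k
            * deriv (\<lambda>s. sum_minors k (jacobian X (at (p + s *\<^sub>R q0)))) 0
            * lam ^ (CARD('n) - k))
         = - poly (char_poly Jtr) lam * (b * lam + 2 * a)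
           - lam\<^sup>2 * mat_trace (adj_mat (lam \<cdot>\<^sub>m 1\<^sub>m (length bs) - Jtr) * Ltr)
       \<and> (CARD('n) = 2 \<longrightarrow>
            mat_trace (adj_mat (lam \<cdot>\<^sub>m 1\<^sub>m (length bs) - Jtr) * Ltr) = 0)"
proof -
  let ?F = "\<lambda>s. jacobian X (at (p + s *\<^sub>R q0))"
  let ?B = "second_derivative X p"
  obtain q1 p0 p1 where BT: "J *v q1 = q0" "linear p0" "linear p1"
      "p0 q0 = 1" "p1 q1 = 1" "p0 q1 = 0" "p1 q0 = 0"
      "\<And>x. x \<in> transverse_space J \<Longrightarrow> p0 x = 0" "\<And>x. x \<in> transverse_space J \<Longrightarrow> p1 x = 0"
    and ab: "a = 1/2 * p1 (?B q0 q0)" "b = p0 (?B q0 q0) + p1 (?B q0 q1)"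
    using assms(11) unfolding BT_coefficients_def Let_def assms(6)[symmetric] by blast
  interpret BT_splitting J q0 q1 p0 p1
    by (rule BT_splitting.intro) (assumption | rule assms(10) BT)+
  note bs = assms(13)
  let ?vs = "q0 # q1 # bs"
  have vs: "ordered_basis UNIV ?vs"
    by (rule extended_basis[OF bs])
  have len: "length bs + 2 = CARD('n)"
    using ordered_basis_UNIV_length[OF vs] by simp
  \<comment> \<open>The Jacobian really is differentiable along the line, so
    \<open>vector_derivative\<close> yields the matrix of the bilinear form with first argument
    \<open>q0\<close>.\<close>
  have F: "(?F has_vector_derivative L) (at 0)" and L: "L = matrix (?B q0)"
    using C2_on_jacobian(2)[OF assms(3,2,4), of q0] vector_derivative_at[OF C2_on_jacobian(2)[OF assms(3,2,4), of q0]]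
    by (simp_all add: assms(12))
  have L_apply: "L *v w = ?B q0 w" for w
    using fun_cong[OF matrix_vector_mul(2)[OF C2_on_jacobian(1)[OF assms(3,2,4), of q0]], of w]
    by (simp add: L)
  have F0: "?F 0 = J"
    using assms(6) by simp
  have entry: "((\<lambda>s. ?F s $ i $ j) has_field_derivative L $ i $ j) (at 0)" for i j
    using bounded_linear.has_vector_derivative[OF
        bounded_linear_compose[OF bounded_linear_vec_nth bounded_linear_vec_nth] F, of i j]
    by (simp add: has_real_derivative_iff_has_vector_derivative)
  let ?S = "\<Sum>k=0..CARD('n). (-1) ^ k * deriv (\<lambda>s. sum_minors k (?F s)) 0 * lam ^ (CARD('n) - k)"
  \<comment> \<open>The basis stays fixed while \<open>s\<close> varies: it is adapted to
    \<open>J\<close>, and the block form is used at \<open>s = 0\<close> only.\<close>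
  let ?C = "\<lambda>s. coord_matrix ?vs ((*v) (Finite_Cartesian_Product.mat lam - ?F s))"
  have "((\<lambda>s. \<Sum>k=0..CARD('n). (-1) ^ k * sum_minors k (?F s) * lam ^ (CARD('n) - k))
      has_field_derivative ?S) (at 0)"
    by (intro DERIV_sum DERIV_cmult_right DERIV_cmult sum_minors_differentiable[OF entry])
  then have deriv_S: "((\<lambda>s. Determinant.det (?C s)) has_field_derivative ?S) (at 0)"
    by (simp only: det_coord_matrix[OF vs] det_mat_minus_eq_sum_minors)
  have "((\<lambda>s. Determinant.det (?C s)) has_field_derivative
      mat_trace (adj_mat (?C 0) * coord_matrix ?vs ((*v) (- L)))) (at 0)"
  proof (rule det_has_field_derivative)
    fix i j assume ij: "i < length ?vs" "j < length ?vs"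
    let ?r = "\<lambda>A. representation (set ?vs) (A *v (?vs ! j)) (?vs ! i)"
    have ind: "independent (set ?vs)" and sp: "x \<in> span (set ?vs)" for x
      using vs by (auto simp: ordered_basis_def)
    \<comment> \<open>For a fixed basis each coordinate entry is linear in the matrix, so
      differentiating \<lambda> I - \<open>?F s\<close> entrywise produces the entries of
      \<open>- L\<close>.\<close>
    have "bounded_linear ?r"
      unfolding linear_conv_bounded_linear[symmetric]
      by (intro linearI) (simp_all only: matrix_vector_mult_add_rdistrib scaleR_matrix_vector_assoc[symmetric]
          real_vector.representation_add[OF ind sp sp] real_vector.representation_scale[OF ind sp] real_scaleR_def)
    moreover have "((\<lambda>s. Finite_Cartesian_Product.mat lam - ?F s) has_vector_derivative - L) (at 0)"
      using has_vector_derivative_diff[OF has_vector_derivative_const F] by simp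
    ultimately have "((\<lambda>s. ?r (Finite_Cartesian_Product.mat lam - ?F s)) has_vector_derivative ?r (- L)) (at 0)"
      by (rule bounded_linear.has_vector_derivative)
    moreover have "coord_matrix ?vs T $$ (i, j) = representation (set ?vs) (T (?vs ! j)) (?vs ! i)" for T
      using ij by (simp add: coord_matrix_def)
    ultimately show "((\<lambda>s. ?C s $$ (i, j)) has_field_derivative
        coord_matrix ?vs ((*v) (- L)) $$ (i, j)) (at 0)"
      by (simp only: has_real_derivative_iff_has_vector_derivative)
  qed (auto simp: coord_matrix_def)
  \<comment> \<open>Two derivatives of one function at 0 coincide. Since \<open>L *v w\<close> is
    \<open>?B q0 w\<close>, the term \<open>p1 (L *v q0)\<close> is 2a and
    \<open>p0 (L *v q0) + p1 (L *v q1)\<close> is b.\<close>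
  from DERIV_unique[OF deriv_S this]
  have S: "?S = - Determinant.det (lam \<cdot>\<^sub>m 1\<^sub>m (length bs) - Jtr) * (b * lam + 2 * a)
      - lam\<^sup>2 * mat_trace (adj_mat (lam \<cdot>\<^sub>m 1\<^sub>m (length bs) - Jtr) * Ltr)"
    unfolding F0 trace_adj_char[OF bs] assms(14,15) ab L_apply by simp
  have Jtr: "Jtr \<in> carrier_mat (length bs) (length bs)"
    by (simp add: assms(14) coord_matrix_def)
  have "poly (char_poly Jtr) lam = Determinant.det (lam \<cdot>\<^sub>m 1\<^sub>m (length bs) - Jtr)"
    unfolding char_poly_matrix[OF Jtr]
    using Jtr by (intro arg_cong[of _ _ Determinant.det] eq_matI) (auto simp: char_matrix_def)
  \<comment> \<open>Here \<open>bs\<close> is empty, so the trace is an empty sum.\<close>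
  moreover have "mat_trace (adj_mat (lam \<cdot>\<^sub>m 1\<^sub>m (length bs) - Jtr) * Ltr) = 0" if "CARD('n) = 2"
    using that len Jtr by (simp add: mat_trace_def adj_mat_def)
  ultimately show ?thesis
    using S by simp
qed

end
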